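(* Let $(X,\delta)$ be a diversity with tight span $(T_X,\delta_T)$ and let $\kappa:X\to T_X$ be the canonical embedding $\kappa(x)=h_x$, $h_x(A)=\delta(A\cup\{x\})$. Let $\phi$ be a non-expansive map from $(T_X,\delta_T)$ to a diversity $(Y,\delta_Y)$. If $\pi=\phi\circ\kappa$ is an embedding from $(X,\delta)$ to $(Y,\delta_Y)$, then $\phi$ is an embedding from $(T_X,\delta_T)$ to $(Y,\delta_Y)$.
   Context: For a set $X$, $\mathcal{P}_{\mathrm{fin}}(X)$ denotes the set of all finite subsets of $X$. A diversity is a pair $(X,\delta)$ where $X$ is a set and $\delta:\mathcal{P}_{\mathrm{fin}}(X)\to\mathbb{R}$ satisfies, for all finite $A,B,C\subseteq X$: (D1) $\delta(A)\ge 0$, and $\delta(A)=0$ if and only if $|A|\le 1$; (D2) if $B\ne\emptyset$ then $\delta(A\cup C)\le\delta(A\cup B)+\delta(B\cup C)$. Given diversities $(Y_1,\delta_1)$ and $(Y_2,\delta_2)$, a map $\phi:Y_1\to Y_2$ is non-expansive if $\delta_1(A)\ge\delta_2(\phi(A))$ for all finite $A\subseteq Y_1$, and it is an embedding if it is injective (one-to-one) and $\delta_1(A)=\delta_2(\phi(A))$ for all finite $A\subseteq Y_1$. Given a diversity $(X,\delta)$, $P_X$ is the set of all functions $f:\mathcal{P}_{\mathrm{fin}}(X)\to\mathbb{R}$ with $f(\emptyset)=0$ and $\sum_{A\in\mathscr{A}}f(A)\ge\delta\big(\bigcup_{A\in\mathscr{A}}A\big)$ for all finite $\mathscr{A}\subseteq\mathcal{P}_{\mathrm{fin}}(X)$.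 Write $f\preceq g$ if $f(A)\le g(A)$ for all finite $A\subseteq X$. The tight span $T_X$ is the set of elements of $P_X$ that are minimal with respect to $\preceq$. The function $\delta_T:\mathcal{P}_{\mathrm{fin}}(T_X)\to\mathbb{R}$ is defined by $\delta_T(\emptyset)=0$ and, for finite non-empty $F\subseteq T_X$, $$\delta_T(F)=\sup\left\{\delta\Big(\bigcup_{A\in\mathscr{A}}A\Big)-\sum_{A\in\mathscr{A}}\inf_{f\in F}f(A):\ \mathscr{A}\subseteq\mathcal{P}_{\mathrm{fin}}(X),\ |\mathscr{A}|<\infty\right\}.$$ The pair $(T_X,\delta_T)$ is a diversity, and $\kappa$ takes values in $T_X$ and is an embedding of $(X,\delta)$ into $(T_X,\delta_T)$. *)

theory Defs
  imports Complex_Main "HOL-Library.FuncSet"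
begin

text \<open>
  The diversity function takes all sets as arguments, but only its values on the finite
  subsets of the carrier, i.e. on \<^term>\<open>Fpow X\<close>, are constrained or used.
\<close>

locale diversity =
  fixes X :: "'a set" and \<delta> :: "'a set \<Rightarrow> real"
  assumes nonneg: "A \<in> Fpow X \<Longrightarrow> 0 \<le> \<delta> A"
    and eq_0_iff: "A \<in> Fpow X \<Longrightarrow> \<delta> A = 0 \<longleftrightarrow> card A \<le> 1"
    and triangle: "\<lbrakk>A \<in> Fpow X; B \<in> Fpow X; C \<in> Fpow X; B \<noteq> {}\<rbrakk>
      \<Longrightarrow> \<delta> (A \<union> C) \<le> \<delta> (A \<union> B) + \<delta> (B \<union> C)"

definition div_nonexpansive ::
  "'a set \<Rightarrow> ('a set \<Rightarrow> real) \<Rightarrow> 'b set \<Rightarrow> ('b set \<Rightarrow> real) \<Rightarrow> ('a \<Rightarrow> 'b) \<Rightarrow> bool" where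
  "div_nonexpansive Y1 \<delta>1 Y2 \<delta>2 \<phi> \<longleftrightarrow>
     \<phi> \<in> Y1 \<rightarrow> Y2 \<and> (\<forall>A\<in>Fpow Y1. \<delta>1 A \<ge> \<delta>2 (\<phi> ` A))"

definition div_embedding ::
  "'a set \<Rightarrow> ('a set \<Rightarrow> real) \<Rightarrow> 'b set \<Rightarrow> ('b set \<Rightarrow> real) \<Rightarrow> ('a \<Rightarrow> 'b) \<Rightarrow> bool" where
  "div_embedding Y1 \<delta>1 Y2 \<delta>2 \<phi> \<longleftrightarrow>
     \<phi> \<in> Y1 \<rightarrow> Y2 \<and> inj_on \<phi> Y1 \<and> (\<forall>A\<in>Fpow Y1. \<delta>1 A = \<delta>2 (\<phi> ` A))"

text \<open>
  A function on the finite subsets of \<^term>\<open>X\<close> is an element of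
  \<^term>\<open>extensional (Fpow X)\<close>, so that equality of such functions is equality of their
  values on \<^term>\<open>Fpow X\<close>.
\<close>

definition div_P :: "'a set \<Rightarrow> ('a set \<Rightarrow> real) \<Rightarrow> ('a set \<Rightarrow> real) set" where
  "div_P X \<delta> =
     {f \<in> extensional (Fpow X).
        f {} = 0 \<and> (\<forall>\<A>\<in>Fpow (Fpow X). (\<Sum>A\<in>\<A>. f A) \<ge> \<delta> (\<Union>\<A>))}"

definition div_le :: "'a set \<Rightarrow> ('a set \<Rightarrow> real) \<Rightarrow> ('a set \<Rightarrow> real) \<Rightarrow> bool" where
  "div_le X f g \<longleftrightarrow> (\<forall>A\<in>Fpow X. f A \<le> g A)"

definition tight_span :: "'a set \<Rightarrow> ('a set \<Rightarrow> real) \<Rightarrow> ('a set \<Rightarrow> real) set" where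
  "tight_span X \<delta> =
     {f \<in> div_P X \<delta>. \<forall>g\<in>div_P X \<delta>. div_le X g f \<longrightarrow> g = f}"

text \<open>
  For a diversity and a finite non-empty set \<open>F\<close> of elements of the tight span, the supremum
  is that of a non-empty set of reals which, for any point \<open>x\<close> of \<open>X\<close>, is bounded above by
  the sum of the \<open>f {x}\<close> over \<open>f \<in> F\<close> (and is \<open>{0}\<close> if \<open>X\<close> is empty). The infimum is that of
  a finite non-empty set.
\<close>

definition tight_span_div ::
  "'a set \<Rightarrow> ('a set \<Rightarrow> real) \<Rightarrow> ('a set \<Rightarrow> real) set \<Rightarrow> real" where
  "tight_span_div X \<delta> F =
     (if F = {} then 0
      else (SUP \<A>\<in>Fpow (Fpow X). \<delta> (\<Union>\<A>) - (\<Sum>A\<in>\<A>. INF f\<in>F. f A)))"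

definition kuratowski :: "'a set \<Rightarrow> ('a set \<Rightarrow> real) \<Rightarrow> 'a \<Rightarrow> 'a set \<Rightarrow> real" where
  "kuratowski X \<delta> x = (\<lambda>A\<in>Fpow X. \<delta> (A \<union> {x}))"

end

theory Submission
  imports Defs
begin

text \<open>
  The tight span is rigid over \<open>X\<close>: each value \<open>f A\<close> of a point \<open>f\<close> bounds the diversity
  \<open>\<delta>\<^sub>T ({f} \<union> \<kappa> ` A)\<close> from above (\<open>tight_span_div_insert_kuratowski_le\<close>), so a non-expansive map
  \<open>\<phi>\<close> that preserves \<open>\<delta>\<close> on \<open>\<kappa> ` X\<close> has no room to shrink anything else. Given a
  finite collection \<open>\<A>\<close> and a finite non-empty \<open>F\<close>, pick for each \<open>A \<in> \<A>\<close> an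
  \<open>f\<^sub>A \<in> F\<close> minimizing \<open>f A\<close>. In \<open>Y\<close>, the set \<open>\<phi> ` F\<close> together with the sets
  \<open>{\<phi> f\<^sub>A} \<union> \<pi> ` A\<close> connects up all of \<open>\<pi> ` \<Union>\<A>\<close>, and iterating the triangle inequality
  gives
  \<open>\<delta> (\<Union>\<A>) = \<delta>\<^sub>Y (\<pi> ` \<Union>\<A>) \<le> \<delta>\<^sub>Y (\<phi> ` F) + (\<Sum>A\<in>\<A>. \<delta>\<^sub>Y ({\<phi> f\<^sub>A} \<union> \<pi> ` A))
  \<le> \<delta>\<^sub>Y (\<phi> ` F) + (\<Sum>A\<in>\<A>. f\<^sub>A A)\<close>, where \<open>\<pi> = \<phi> \<circ> \<kappa>\<close>.
  Taking the supremum over \<open>\<A>\<close> yields \<open>\<delta>\<^sub>T F \<le> \<delta>\<^sub>Y (\<phi> ` F)\<close>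
  (\<open>tight_span_term_le_image\<close>), the reverse of non-expansiveness.

  Injectivity comes from the same inequality: if \<open>\<phi> f = \<phi> g\<close>, then for \<open>F = {f, g}\<close> the
  right-hand side \<open>\<delta>\<^sub>Y (\<phi> ` F)\<close> vanishes, which says exactly that the pointwise minimum of
  \<open>f\<close> and \<open>g\<close> belongs to \<open>P\<^sub>X\<close>; minimality forces both to equal it.
\<close>

lemma Union_in_Fpow: "\<A> \<in> Fpow (Fpow X) \<Longrightarrow> \<Union>\<A> \<in> Fpow X"
  by (auto simp: Fpow_def)

lemma Un_in_Fpow: "A \<in> Fpow X \<Longrightarrow> B \<in> Fpow X \<Longrightarrow> A \<union> B \<in> Fpow X"
  by (auto simp: Fpow_def)

lemma finite_INF_attained:
  fixes u :: "'c \<Rightarrow> real"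
  assumes "finite F" "F \<noteq> {}"
  obtains f where "f \<in> F" "u f = (INF f\<in>F. u f)"
  using assms Min_in[of "u ` F"] cInf_eq_Min[of "u ` F"] by fastforce

context diversity
begin

lemma empty_eq_0: "\<delta> {} = 0"
  using eq_0_iff[of "{}"] by (simp add: Fpow_def)

lemma singleton_eq_0: "x \<in> X \<Longrightarrow> \<delta> {x} = 0"
  using eq_0_iff[of "{x}"] by (simp add: Fpow_def)

lemma le_insert:
  assumes "A \<in> Fpow X" "x \<in> X"
  shows "\<delta> A \<le> \<delta> (insert x A)"
  using triangle[of A "{x}" "{}"] singleton_eq_0[of x] assms by (simp add: Fpow_def)

lemma mono:
  assumes "B \<in> Fpow X" "A \<subseteq> B"
  shows "\<delta> A \<le> \<delta> B"
proof -
  have "\<delta> A \<le> \<delta> (C \<union> A)" if "finite C" "C \<subseteq> X" for C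
    using that
  proof (induction C)
    case (insert c C)
    moreover have "C \<union> A \<in> Fpow X"
      using insert assms by (auto simp: Fpow_def intro: finite_subset)
    ultimately show ?case
      using le_insert[of "C \<union> A" c] by auto
  qed simp
  from this[of B] show ?thesis
    using assms by (auto simp: Fpow_def Un_absorb2)
qed

text \<open>
  Gluing finitely many sets \<open>C i\<close> onto a common core \<open>D\<close>, each through a point \<open>b i\<close> of the
  core, costs at most the sum of the diversities of the pieces. All uses of the triangle
  inequality below go through this form of it.
\<close>
lemma star_triangle:
  assumes "finite I" "D \<in> Fpow X"
    and "\<And>i. i \<in> I \<Longrightarrow> C i \<in> Fpow X"
    and "\<And>i. i \<in> I \<Longrightarrow> b i \<in> D"
  shows "\<delta> (D \<union> (\<Union>i\<in>I. C i)) \<le> \<delta> D + (\<Sum>i\<in>I. \<delta> (insert (b i) (C i)))"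
  using assms
proof (induction I)
  case (insert i I)
  let ?U = "D \<union> (\<Union>i\<in>I. C i)"
  have "?U \<in> Fpow X" "{b i} \<in> Fpow X" "?U \<union> {b i} = ?U"
    using insert by (auto simp: Fpow_def)
  then have "\<delta> (?U \<union> C i) \<le> \<delta> ?U + \<delta> (insert (b i) (C i))"
    using triangle[of ?U "{b i}" "C i"] insert by simp
  moreover have "D \<union> (\<Union>j\<in>insert i I. C j) = ?U \<union> C i"
    by auto
  ultimately show ?case
    using insert by simp
qed simp

lemma div_P_Union_le:
  assumes "f \<in> div_P X \<delta>" "\<A> \<in> Fpow (Fpow X)"
  shows "\<delta> (\<Union>\<A>) \<le> sum f \<A>"
proof -
  have "\<forall>\<A>\<in>Fpow (Fpow X). sum f \<A> \<ge> \<delta> (\<Union>\<A>)"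
    using assms(1) unfolding div_P_def by simp
  then show ?thesis
    using assms(2) by (rule bspec)
qed

lemma div_P_nonneg:
  assumes "f \<in> div_P X \<delta>" "A \<in> Fpow X"
  shows "0 \<le> f A"
  using div_P_Union_le[OF assms(1), of "{A}"] nonneg[of A] assms(2) by (simp add: Fpow_def)

lemma kuratowski_in_div_P:
  assumes "x \<in> X"
  shows "kuratowski X \<delta> x \<in> div_P X \<delta>"
proof -
  have "\<delta> (\<Union>\<A>) \<le> (\<Sum>A\<in>\<A>. kuratowski X \<delta> x A)" if "\<A> \<in> Fpow (Fpow X)" for \<A>
  proof -
    have "\<delta> (\<Union>\<A>) \<le> \<delta> ({x} \<union> \<Union>\<A>)"
      using le_insert[of "\<Union>\<A>" x] Union_in_Fpow[OF that] assms by simp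
    also have "\<dots> \<le> \<delta> {x} + (\<Sum>A\<in>\<A>. \<delta> (insert x A))"
      using star_triangle[of \<A> "{x}" "\<lambda>A. A" "\<lambda>_. x"] that assms by (auto simp: Fpow_def)
    also have "\<dots> = (\<Sum>A\<in>\<A>. kuratowski X \<delta> x A)"
      using that assms
      by (auto simp: singleton_eq_0 kuratowski_def Fpow_def intro!: sum.cong)
    finally show ?thesis .
  qed
  then show ?thesis
    using assms
    by (auto simp: div_P_def kuratowski_def singleton_eq_0 empty_in_Fpow)
qed

text \<open>
  Minimality: any \<open>g \<preceq> h\<^sub>x\<close> in \<open>P\<^sub>X\<close> vanishes at \<open>{x}\<close>, so applying the covering inequality
  to the collection \<open>{A, {x}}\<close> leaves \<open>\<delta> (A \<union> {x}) \<le> g A\<close>.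
\<close>
lemma kuratowski_in_tight_span:
  assumes "x \<in> X"
  shows "kuratowski X \<delta> x \<in> tight_span X \<delta>"
proof -
  have "g = kuratowski X \<delta> x"
    if g: "g \<in> div_P X \<delta>" and le: "div_le X g (kuratowski X \<delta> x)" for g
  proof
    fix A
    show "g A = kuratowski X \<delta> x A"
    proof (cases "A \<in> Fpow X")
      case True
      have x: "{x} \<in> Fpow X"
        using assms by (simp add: Fpow_def)
      have "g {x} \<le> \<delta> {x}"
        using le x by (auto simp: div_le_def kuratowski_def)
      then have g0: "g {x} = 0"
        using div_P_nonneg[OF g x] assms by (simp add: singleton_eq_0)
      have "\<delta> (\<Union>{A, {x}}) \<le> sum g {A, {x}}"
        using True x by (intro div_P_Union_le[OF g]) (simp add: Fpow_def)
      then have "\<delta> (A \<union> {x}) \<le> g A"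
        using g0 by (cases "A = {x}") auto
      then show ?thesis
        using le True by (auto simp: div_le_def kuratowski_def intro: antisym)
    next
      case False
      then show ?thesis
        using g by (auto simp: div_P_def kuratowski_def extensional_def)
    qed
  qed
  with kuratowski_in_div_P[OF assms] show ?thesis
    by (auto simp: tight_span_def)
qed

text \<open>
  Given \<open>\<B>\<close>, split it into the members \<open>B\<close> at which \<open>f\<close> attains the infimum and those at
  which some \<open>h\<^sub>a\<close> with \<open>a \<in> A\<close> does. The former, together with \<open>A\<close> itself,
  form a core whose diversity is controlled by \<open>f\<close>; the latter attach to it through points
  of \<open>A\<close>, each at cost \<open>\<delta> (B \<union> {a}) = h\<^sub>a B\<close>. The only overhead is the one extra term \<open>f A\<close>.
\<close>
lemma tight_span_div_insert_kuratowski_le: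
  assumes f: "f \<in> div_P X \<delta>" and A: "A \<in> Fpow X"
  shows "tight_span_div X \<delta> (insert f (kuratowski X \<delta> ` A)) \<le> f A"
proof -
  let ?F = "insert f (kuratowski X \<delta> ` A)"
  have finF: "finite ?F"
    using A by (simp add: Fpow_def)
  have "\<delta> (\<Union>\<B>) - (\<Sum>B\<in>\<B>. INF g\<in>?F. g B) \<le> f A" if \<B>: "\<B> \<in> Fpow (Fpow X)" for \<B>
  proof -
    define \<B>1 where "\<B>1 = {B \<in> \<B>. f B = (INF g\<in>?F. g B)}"
    define \<B>2 where "\<B>2 = \<B> - \<B>1"
    have fin: "finite \<B>1" "finite \<B>2" and split: "\<B> = \<B>1 \<union> \<B>2" "\<B>1 \<inter> \<B>2 = {}"
      and sub: "\<B>1 \<subseteq> Fpow X" "\<B>2 \<subseteq> Fpow X"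
      using \<B> by (auto simp: \<B>1_def \<B>2_def Fpow_def)
    have "\<exists>a. a \<in> A \<and> \<delta> (insert a B) = (INF g\<in>?F. g B)" if "B \<in> \<B>2" for B
    proof -
      obtain g where g: "g \<in> ?F" "g B = (INF g\<in>?F. g B)"
        using finite_INF_attained[OF finF, of "\<lambda>g. g B"] by blast
      then have "g \<noteq> f"
        using that by (auto simp: \<B>1_def \<B>2_def)
      then obtain a where "a \<in> A" "g = kuratowski X \<delta> a"
        using g by auto
      moreover have "kuratowski X \<delta> a B = \<delta> (insert a B)"
        using that sub by (auto simp: kuratowski_def)
      ultimately show ?thesis
        using g(2) by auto
    qed
    then obtain a where a: "\<And>B. B \<in> \<B>2 \<Longrightarrow> a B \<in> A"
      "\<And>B. B \<in> \<B>2 \<Longrightarrow> \<delta> (insert (a B) B) = (INF g\<in>?F. g B)"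
      by metis
    let ?D = "\<Union>(insert A \<B>1)"
    have ins: "insert A \<B>1 \<in> Fpow (Fpow X)"
      using A fin sub by (auto simp: Fpow_def)
    have "\<delta> ?D \<le> sum f (insert A \<B>1)"
      using div_P_Union_le[OF f ins] .
    also have "\<dots> \<le> f A + (\<Sum>B\<in>\<B>1. f B)"
      using fin div_P_nonneg[OF f A] by (cases "A \<in> \<B>1") (auto simp: insert_absorb)
    finally have core: "\<delta> ?D \<le> f A + (\<Sum>B\<in>\<B>1. f B)" .
    have D: "?D \<in> Fpow X"
      using Union_in_Fpow[OF ins] .
    have "\<delta> (\<Union>\<B>) \<le> \<delta> (?D \<union> (\<Union>B\<in>\<B>2. B))"
      using split Un_in_Fpow[OF D Union_in_Fpow[of \<B>2]] fin sub
      by (intro mono) (auto simp: Fpow_def)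
    also have "\<dots> \<le> \<delta> ?D + (\<Sum>B\<in>\<B>2. \<delta> (insert (a B) B))"
      using fin sub a D by (intro star_triangle) auto
    also have "\<dots> \<le> f A + (\<Sum>B\<in>\<B>1. f B) + (\<Sum>B\<in>\<B>2. INF g\<in>?F. g B)"
      using core a by simp
    also have "\<dots> = f A + (\<Sum>B\<in>\<B>. INF g\<in>?F. g B)"
      unfolding split(1) sum.union_disjoint[OF fin split(2)] by (simp add: \<B>1_def)
    finally show ?thesis
      by simp
  qed
  moreover have "Fpow (Fpow X) \<noteq> {}"
    by (auto simp: Fpow_def)
  ultimately show ?thesis
    by (simp add: tight_span_div_def cSUP_least)
qed

text \<open>
  Each term of the supremum defining \<open>\<delta>\<^sub>T F\<close> is bounded by \<open>\<delta>\<^sub>Y (\<phi> ` F)\<close>. In \<open>Y\<close>, the core is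
  \<open>\<phi> ` F\<close>, and \<open>\<pi> ` A\<close> is attached to it through the image of a minimizer of \<open>f A\<close>, at cost at
  most \<open>\<delta>\<^sub>T ({f} \<union> \<kappa> ` A) \<le> f A\<close>.
\<close>
lemma tight_span_term_le_image:
  assumes Y: "diversity Y \<delta>\<^sub>Y"
    and nonexp: "div_nonexpansive (tight_span X \<delta>) (tight_span_div X \<delta>) Y \<delta>\<^sub>Y \<phi>"
    and emb: "div_embedding X \<delta> Y \<delta>\<^sub>Y (\<phi> \<circ> kuratowski X \<delta>)"
    and F: "F \<in> Fpow (tight_span X \<delta>)" "F \<noteq> {}"
    and \<A>: "\<A> \<in> Fpow (Fpow X)"
  shows "\<delta> (\<Union>\<A>) - (\<Sum>A\<in>\<A>. INF f\<in>F. f A) \<le> \<delta>\<^sub>Y (\<phi> ` F)"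
proof -
  interpret Y: diversity Y \<delta>\<^sub>Y by fact
  let ?\<pi> = "\<phi> \<circ> kuratowski X \<delta>"
  have "finite F" and F_sub: "F \<subseteq> tight_span X \<delta>"
    using F by (auto simp: Fpow_def)
  then have "\<exists>f. f \<in> F \<and> f A = (INF f\<in>F. f A)" for A
    using finite_INF_attained[of F "\<lambda>f. f A"] F by metis
  then obtain m where m: "\<And>A. m A \<in> F" "\<And>A. m A A = (INF f\<in>F. f A)"
    by metis
  have \<phi>F: "\<phi> ` F \<in> Fpow Y"
    using F nonexp by (auto simp: Fpow_def div_nonexpansive_def)
  have \<pi>: "?\<pi> ` A \<in> Fpow Y" if "A \<in> Fpow X" for A
    using that emb by (auto simp: Fpow_def div_embedding_def)
  have U: "\<Union>\<A> \<in> Fpow X" and fin\<A>: "finite \<A>" and \<A>_sub: "\<A> \<subseteq> Fpow X"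
    using \<A> Union_in_Fpow by (auto simp: Fpow_def)
  have cost: "\<delta>\<^sub>Y (insert (\<phi> (m A)) (?\<pi> ` A)) \<le> (INF f\<in>F. f A)" if "A \<in> \<A>" for A
  proof -
    let ?G = "insert (m A) (kuratowski X \<delta> ` A)"
    have A: "A \<in> Fpow X"
      using that \<A>_sub by auto
    have "?G \<in> Fpow (tight_span X \<delta>)"
      using A m(1)[of A] F_sub kuratowski_in_tight_span by (auto simp: Fpow_def)
    then have "\<delta>\<^sub>Y (\<phi> ` ?G) \<le> tight_span_div X \<delta> ?G"
      using nonexp by (auto simp: div_nonexpansive_def)
    also have "\<dots> \<le> m A A"
      using A m(1)[of A] F_sub
      by (intro tight_span_div_insert_kuratowski_le) (auto simp: tight_span_def)
    finally show ?thesis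
      using m(2)[of A] by (simp add: image_comp)
  qed
  have "\<delta> (\<Union>\<A>) = \<delta>\<^sub>Y (?\<pi> ` \<Union>\<A>)"
    using emb U by (auto simp: div_embedding_def)
  also have "\<dots> \<le> \<delta>\<^sub>Y (\<phi> ` F \<union> (\<Union>A\<in>\<A>. ?\<pi> ` A))"
    using Un_in_Fpow[OF \<phi>F \<pi>[OF U]] by (intro Y.mono) (auto simp: image_Union)
  also have "\<dots> \<le> \<delta>\<^sub>Y (\<phi> ` F) + (\<Sum>A\<in>\<A>. \<delta>\<^sub>Y (insert (\<phi> (m A)) (?\<pi> ` A)))"
    using fin\<A> \<phi>F \<pi> \<A>_sub m(1) by (intro Y.star_triangle) auto
  also have "\<dots> \<le> \<delta>\<^sub>Y (\<phi> ` F) + (\<Sum>A\<in>\<A>. INF f\<in>F. f A)"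
    using cost by (intro add_left_mono sum_mono)
  finally show ?thesis
    by simp
qed

text \<open>
  The hypothesis says that the supremum defining \<open>\<delta>\<^sub>T {f, g}\<close> is at most \<open>0\<close>. It puts the
  pointwise minimum of \<open>f\<close> and \<open>g\<close> in \<open>P\<^sub>X\<close>, below two minimal elements.
\<close>
lemma tight_span_eqI:
  assumes f: "f \<in> tight_span X \<delta>" and g: "g \<in> tight_span X \<delta>"
    and le: "\<And>\<A>. \<A> \<in> Fpow (Fpow X) \<Longrightarrow> \<delta> (\<Union>\<A>) \<le> (\<Sum>A\<in>\<A>. min (f A) (g A))"
  shows "f = g"
proof -
  let ?h = "\<lambda>A. min (f A) (g A)"
  have "?h \<in> div_P X \<delta>"
    using f g le by (auto simp: div_P_def tight_span_def extensional_def)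
  moreover have "div_le X ?h f" "div_le X ?h g"
    by (auto simp: div_le_def)
  ultimately have "?h = f" "?h = g"
    using f g unfolding tight_span_def by blast+
  then show ?thesis
    by simp
qed

end

theorem lemma3p7:
  fixes X :: "'a set" and \<delta> :: "'a set \<Rightarrow> real"
    and Y :: "'b set" and \<delta>\<^sub>Y :: "'b set \<Rightarrow> real"
    and \<phi> :: "('a set \<Rightarrow> real) \<Rightarrow> 'b"
  assumes "diversity X \<delta>"
    and "diversity Y \<delta>\<^sub>Y"
    and "div_nonexpansive (tight_span X \<delta>) (tight_span_div X \<delta>) Y \<delta>\<^sub>Y \<phi>"
    and "div_embedding X \<delta> Y \<delta>\<^sub>Y (\<phi> \<circ> kuratowski X \<delta>)"
  shows "div_embedding (tight_span X \<delta>) (tight_span_div X \<delta>) Y \<delta>\<^sub>Y \<phi>"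
proof -
  interpret diversity X \<delta> by fact
  interpret Y: diversity Y \<delta>\<^sub>Y by fact
  note bound = tight_span_term_le_image[OF assms(2-4)]
  have into: "\<phi> \<in> tight_span X \<delta> \<rightarrow> Y"
    using assms(3) by (simp add: div_nonexpansive_def)
  have "inj_on \<phi> (tight_span X \<delta>)"
  proof (rule inj_onI)
    fix f g
    assume f: "f \<in> tight_span X \<delta>" and g: "g \<in> tight_span X \<delta>" and eq: "\<phi> f = \<phi> g"
    show "f = g"
    proof (rule tight_span_eqI[OF f g])
      fix \<A>
      assume "\<A> \<in> Fpow (Fpow X)"
      then have "\<delta> (\<Union>\<A>) - (\<Sum>A\<in>\<A>. INF h\<in>{f, g}. h A) \<le> \<delta>\<^sub>Y (\<phi> ` {f, g})"
        using f g by (intro bound) (auto simp: Fpow_def)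
      moreover have "\<delta>\<^sub>Y (\<phi> ` {f, g}) = 0"
        using eq Y.singleton_eq_0[OF funcset_mem[OF into g]] by simp
      moreover have "(INF h\<in>{f, g}. h A) = min (f A) (g A)" for A
        by (simp add: cInf_eq_Min)
      ultimately show "\<delta> (\<Union>\<A>) \<le> (\<Sum>A\<in>\<A>. min (f A) (g A))"
        by simp
    qed
  qed
  moreover have "tight_span_div X \<delta> F = \<delta>\<^sub>Y (\<phi> ` F)" if F: "F \<in> Fpow (tight_span X \<delta>)" for F
  proof (cases "F = {}")
    case True
    then show ?thesis
      by (simp add: tight_span_div_def Y.empty_eq_0)
  next
    case False
    have "Fpow (Fpow X) \<noteq> {}"
      by (auto simp: Fpow_def)
    then have "tight_span_div X \<delta> F \<le> \<delta>\<^sub>Y (\<phi> ` F)"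
      using False bound[OF F False] by (simp add: tight_span_div_def cSUP_least)
    moreover have "\<delta>\<^sub>Y (\<phi> ` F) \<le> tight_span_div X \<delta> F"
      using assms(3) F by (auto simp: div_nonexpansive_def)
    ultimately show ?thesis
      by simp
  qed
  ultimately show ?thesis
    using into by (simp add: div_embedding_def)
qed

end
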